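(* Let $A\in\mathfrak{gl}(n,\mathbb{H})$ be an arbitrary $\mathrm{Ad}_{\mathrm{GL}(n,\mathbb{H})}$-real element. Suppose that in the Jordan decomposition of $A$ every Jordan block corresponding to a non-zero eigenvalue class with purely imaginary complex representative has even multiplicity; that is, for every real $\nu>0$ and every integer $m\geq 1$, the block $\mathrm{J}(\nu\mathbf{i},m)$ occurs an even number (possibly zero) of times in the Jordan form of $A$. Then $A$ is strongly $\mathrm{Ad}_{\mathrm{GL}(n,\mathbb{H})}$-real.
   Context: $\mathbb{H}=\mathbb{R}+\mathbb{R}\mathbf{i}+\mathbb{R}\mathbf{j}+\mathbb{R}\mathbf{k}$ denotes the quaternions, with $\mathbb{C}=\mathbb{R}+\mathbb{R}\mathbf{i}\subset\mathbb{H}$; $\mathfrak{gl}(n,\mathbb{H})=\mathrm{M}(n,\mathbb{H})$ is the space of $n\times n$ quaternionic matrices. An element $X\in\mathfrak{gl}(n,\mathbb{H})$ is called $\mathrm{Ad}_{\mathrm{GL}(n,\mathbb{H})}$-real if $gXg^{-1}=-X$ for some $g\in\mathrm{GL}(n,\mathbb{H})$, and strongly $\mathrm{Ad}_{\mathrm{GL}(n,\mathbb{H})}$-real if $\tau X\tau^{-1}=-X$ for some involution $\tau\in\mathrm{GL}(n,\mathbb{H})$, i.e. an element with $\tau^2=\mathrm{I}_n$. $\mathrm{J}(\lambda,m)$ is the $m\times m$ matrix with $\lambda$ on the diagonal, $1$ on all superdiagonal entries, and $0$ elsewhere. Jordan form over $\mathbb{H}$: every $A\in\mathrm{M}(n,\mathbb{H})$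 is conjugate under $\mathrm{GL}(n,\mathbb{H})$ to a block diagonal matrix $\mathrm{J}(\lambda_1,m_1)\oplus\cdots\oplus\mathrm{J}(\lambda_k,m_k)$, unique up to permutation of blocks, with $\lambda_1,\dots,\lambda_k\in\mathbb{C}$ (not necessarily distinct) having non-negative imaginary parts. Right eigenvalues of $A$ occur in similarity classes in $\mathbb{H}$, each of which contains a unique complex number with non-negative imaginary part, called its complex representative. *)

theory Defs
  imports "HOL-Library.Multiset" "Jordan_Normal_Form.Jordan_Normal_Form"
begin

text \<open>\<open>Quat a b c d\<close> is \<open>a + b i + c j + d k\<close>.\<close>

datatype quat = Quat (qRe: real) (qI: real) (qJ: real) (qK: real)

instantiation quat :: division_ring
begin

definition zero_quat :: quat where "0 = Quat 0 0 0 0"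

definition one_quat :: quat where "1 = Quat 1 0 0 0"

definition plus_quat :: "quat \<Rightarrow> quat \<Rightarrow> quat" where
  "x + y = Quat (qRe x + qRe y) (qI x + qI y) (qJ x + qJ y) (qK x + qK y)"

definition uminus_quat :: "quat \<Rightarrow> quat" where
  "- x = Quat (- qRe x) (- qI x) (- qJ x) (- qK x)"

definition minus_quat :: "quat \<Rightarrow> quat \<Rightarrow> quat" where
  "x - y = Quat (qRe x - qRe y) (qI x - qI y) (qJ x - qJ y) (qK x - qK y)"

definition times_quat :: "quat \<Rightarrow> quat \<Rightarrow> quat" where
  "x * y = Quat
     (qRe x * qRe y - qI x * qI y - qJ x * qJ y - qK x * qK y)
     (qRe x * qI y + qI x * qRe y + qJ x * qK y - qK x * qJ y)
     (qRe x * qJ y - qI x * qK y + qJ x * qRe y + qK x * qI y)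
     (qRe x * qK y + qI x * qJ y - qJ x * qI y + qK x * qRe y)"

definition inverse_quat :: "quat \<Rightarrow> quat" where
  "inverse x = (let N = (qRe x)\<^sup>2 + (qI x)\<^sup>2 + (qJ x)\<^sup>2 + (qK x)\<^sup>2
     in Quat (qRe x / N) (- qI x / N) (- qJ x / N) (- qK x / N))"

definition divide_quat :: "quat \<Rightarrow> quat \<Rightarrow> quat" where
  "x div y = x * inverse (y :: quat)"

instance
proof
  fix x y z :: quat
  show "x * y * z = x * (y * z)"
    by (simp add: times_quat_def algebra_simps)
  show "x + y + z = x + (y + z)" "x + y = y + x" "0 + x = x" "- x + x = 0" "x - y = x + - y"
    by (simp_all add: plus_quat_def zero_quat_def uminus_quat_def minus_quat_def)
  show "1 * x = x" "x * 1 = x" "(0::quat) \<noteq> 1"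
    by (simp_all add: times_quat_def one_quat_def zero_quat_def)
  show "(x + y) * z = x * z + y * z" "x * (y + z) = x * y + x * z"
    by (simp_all add: times_quat_def plus_quat_def algebra_simps)
  show "inverse (0::quat) = 0"
    by (simp add: inverse_quat_def zero_quat_def)
  show "x div y = x * inverse y"
    by (rule divide_quat_def)
  assume "x \<noteq> 0"
  define N where "N = (qRe x)\<^sup>2 + (qI x)\<^sup>2 + (qJ x)\<^sup>2 + (qK x)\<^sup>2"
  have "N \<noteq> 0"
    using \<open>x \<noteq> 0\<close>
    by (cases x) (auto simp: N_def zero_quat_def add_nonneg_eq_0_iff)
  have "qRe x * qRe x / N + qI x * qI x / N + qJ x * qJ x / N + qK x * qK x / N = N / N"
    unfolding add_divide_distrib[symmetric] by (simp add: N_def power2_eq_square)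
  then have 1: "qRe x * qRe x / N + qI x * qI x / N + qJ x * qJ x / N + qK x * qK x / N = 1"
    using \<open>N \<noteq> 0\<close> by simp
  have inv: "inverse x = Quat (qRe x / N) (- qI x / N) (- qJ x / N) (- qK x / N)"
    by (simp add: inverse_quat_def N_def Let_def)
  show "inverse x * x = 1" "x * inverse x = 1"
    unfolding inv using 1 by (simp_all add: times_quat_def one_quat_def mult.commute)
qed

end

definition quat_of_complex :: "complex \<Rightarrow> quat" where
  "quat_of_complex z = Quat (Re z) (Im z) 0 0"

text \<open>In \<open>similar_mat_wit (- X) X g h\<close> the matrix \<open>h\<close> is the two-sided inverse of \<open>g\<close> and
  \<open>- X = g * X * h\<close>.\<close>

definition Ad_real :: "nat \<Rightarrow> quat mat \<Rightarrow> bool" where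
  "Ad_real n X \<longleftrightarrow> X \<in> carrier_mat n n \<and> (\<exists>g h. similar_mat_wit (- X) X g h)"

definition strongly_Ad_real :: "nat \<Rightarrow> quat mat \<Rightarrow> bool" where
  "strongly_Ad_real n X \<longleftrightarrow> X \<in> carrier_mat n n \<and>
     (\<exists>g h. similar_mat_wit (- X) X g h \<and> g * g = 1\<^sub>m n)"

text \<open>\<open>bs\<close> lists the sizes and eigenvalues \<open>(m, z)\<close> of the blocks. \<^const>\<open>jordan_nf\<close> gives
  positive sizes and conjugacy over the quaternions; the eigenvalues are normalised to the
  closed upper half plane, which makes the list unique up to order.\<close>

definition quat_jordan_form :: "quat mat \<Rightarrow> (nat \<times> complex) list \<Rightarrow> bool" where
  "quat_jordan_form A bs \<longleftrightarrow>
     jordan_nf A (map (\<lambda>(m, z). (m, quat_of_complex z)) bs) \<and> (\<forall>(m, z) \<in> set bs. Im z \<ge> 0)"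

end

theory Submission
  imports Defs "Jordan_Normal_Form.Jordan_Normal_Form_Uniqueness"
begin

text \<open>Writing quaternions as \<open>z + w j\<close> embeds \<open>M(n, \<real> + \<real> i + \<real> j + \<real> k)\<close> into \<open>M(2n, \<complex>)\<close>;
  a block \<open>J(z, m)\<close> becomes \<open>J(z, m) \<oplus> J(cnj z, m)\<close>. Uniqueness of the complex Jordan form applied to
  \<open>A\<close> and \<open>- A\<close> therefore shows that \<open>J(z, m)\<close> and \<open>J(- cnj z, m)\<close> are equally frequent in the
  Jordan form of a real \<open>A\<close>. With the parity hypothesis the blocks with non-zero eigenvalue split
  into pairs \<open>J(z, m) \<oplus> J(- cnj z, m)\<close>; conjugation by an alternating diagonal matrix with entries
  \<open>j, - j, j, \<dots>\<close> takes the second block to the negative of the first, so an involution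
  swapping the two summands negates the pair. A block \<open>J(0, m)\<close> is negated by
  \<open>diag(1, - 1, 1, \<dots>)\<close>.\<close>

section \<open>Complexification of quaternionic matrices\<close>

text \<open>With \<open>quat_snd\<close>, the components of \<open>q = z + w * j\<close>; since
  \<open>k = i * j\<close>, the coefficient of \<open>k\<close> is the imaginary part of
  \<open>w\<close>.\<close>

definition quat_fst :: "quat \<Rightarrow> complex" where
  "quat_fst q = Complex (qRe q) (qI q)"

definition quat_snd :: "quat \<Rightarrow> complex" where
  "quat_snd q = Complex (qJ q) (qK q)"

text \<open>The classical matrix of \<open>z + w * j\<close> has rows \<open>(z, w)\<close> and
  \<open>(- cnj w, cnj z)\<close>. Collecting equal positions into blocks makes a complex matrix
  \<open>B\<close> complexify to the direct sum of \<open>B\<close> and its conjugate.\<close>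

definition complexify :: "quat mat \<Rightarrow> complex mat" where
  "complexify A = four_block_mat (map_mat quat_fst A) (map_mat quat_snd A)
     (map_mat (\<lambda>q. - cnj (quat_snd q)) A) (map_mat (\<lambda>q. cnj (quat_fst q)) A)"

lemma quat_fst_simps [simp]:
  "quat_fst 0 = 0" "quat_fst 1 = 1" "quat_fst (x + y) = quat_fst x + quat_fst y"
  "quat_fst (- x) = - quat_fst x" "quat_fst (quat_of_complex z) = z"
  "quat_fst (x * y) = quat_fst x * quat_fst y + quat_snd x * (- cnj (quat_snd y))"
  by (simp_all add: quat_fst_def quat_snd_def zero_quat_def one_quat_def plus_quat_def
      uminus_quat_def times_quat_def quat_of_complex_def complex_eq_iff)

lemma quat_snd_simps [simp]:
  "quat_snd 0 = 0" "quat_snd 1 = 0" "quat_snd (x + y) = quat_snd x + quat_snd y"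
  "quat_snd (- x) = - quat_snd x" "quat_snd (quat_of_complex z) = 0"
  "quat_snd (x * y) = quat_fst x * quat_snd y + quat_snd x * cnj (quat_fst y)"
  by (simp_all add: quat_fst_def quat_snd_def zero_quat_def one_quat_def plus_quat_def
      uminus_quat_def times_quat_def quat_of_complex_def complex_eq_iff)

lemma quat_of_complex_simps [simp]:
  "quat_of_complex 0 = 0" "quat_of_complex 1 = 1"
  by (simp_all add: quat_of_complex_def zero_quat_def one_quat_def)

text \<open>Computes each of the four blocks of a complexified product: \<open>f_mult\<close> is one
  row times column rule of the two by two block product.\<close>

lemma map_mat_mult_bilinear:
  fixes A B :: "'a::semiring_0 mat" and f g1 h1 g2 h2 :: "'a \<Rightarrow> 'b::semiring_0"
  assumes A: "A \<in> carrier_mat nr n" and B: "B \<in> carrier_mat n nc"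
    and f0: "f 0 = 0" and f_add: "\<And>x y. f (x + y) = f x + f y"
    and f_mult: "\<And>x y. f (x * y) = g1 x * h1 y + g2 x * h2 y"
  shows "map_mat f (A * B) = map_mat g1 A * map_mat h1 B + map_mat g2 A * map_mat h2 B"
proof -
  have f_sum: "f (sum F S) = (\<Sum>i\<in>S. f (F i))" for F :: "nat \<Rightarrow> 'a" and S
    by (induction S rule: infinite_finite_induct) (simp_all add: f0 f_add)
  show ?thesis
    using A B
    by (intro eq_matI) (simp_all add: scalar_prod_def f_sum f_mult sum.distrib)
qed

lemma complexify_carrier [simp]:
  "A \<in> carrier_mat n n \<Longrightarrow> complexify A \<in> carrier_mat (n + n) (n + n)"
  by (simp add: complexify_def)

lemma complexify_mult:
  assumes A: "A \<in> carrier_mat n n" and B: "B \<in> carrier_mat n n"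
  shows "complexify (A * B) = complexify A * complexify B"
  unfolding complexify_def
  by (subst mult_four_block_mat[where ?nr1.0 = n and ?nr2.0 = n and ?n1.0 = n and ?n2.0 = n
        and ?nc1.0 = n and ?nc2.0 = n], (simp_all add: A B)[8])
    (intro cong_four_block_mat map_mat_mult_bilinear[OF A B]; simp add: algebra_simps)

lemma complexify_one [simp]: "complexify (1\<^sub>m n) = 1\<^sub>m (n + n)"
  unfolding complexify_def four_block_one_mat[symmetric]
  by (intro cong_four_block_mat eq_matI) simp_all

lemma complexify_uminus: "complexify (- A) = - complexify A"
  unfolding complexify_def by (rule eq_matI) auto

lemma similar_mat_complexify:
  assumes "similar_mat A B"
  shows "similar_mat (complexify A) (complexify B)"
proof -
  obtain n P Q where carrier: "{A, B, P, Q} \<subseteq> carrier_mat n n"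
    and inv: "P * Q = 1\<^sub>m n" "Q * P = 1\<^sub>m n" and A: "A = P * B * Q"
    using similar_matD[OF assms] by blast
  show ?thesis
  proof (rule similar_matI)
    show "{complexify A, complexify B, complexify P, complexify Q} \<subseteq> carrier_mat (n + n) (n + n)"
      using carrier by simp
    show "complexify P * complexify Q = 1\<^sub>m (n + n)" "complexify Q * complexify P = 1\<^sub>m (n + n)"
      using carrier inv complexify_mult[of P n Q] complexify_mult[of Q n P] by simp_all
    show "complexify A = complexify P * complexify B * complexify Q"
      using carrier mult_carrier_mat[of P n n B n]
      by (simp add: A complexify_mult[of "P * B" n Q] complexify_mult[of P n B])
  qed
qed

section \<open>Jordan matrices under direct sums, entrywise maps and complexification\<close>

lemma jordan_matrix_append:
  "jordan_matrix (xs @ ys) = four_block_mat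
     (jordan_matrix xs) (0\<^sub>m (sum_list (map fst xs)) (sum_list (map fst ys)))
     (0\<^sub>m (sum_list (map fst ys)) (sum_list (map fst xs))) (jordan_matrix ys)"
  using jordan_matrix_dim[of xs] jordan_matrix_dim[of ys]
  unfolding jordan_matrix_def map_append diag_block_mat_append Let_def by simp

lemma map_mat_jordan_matrix:
  assumes "f 0 = 0" and "f 1 = 1"
  shows "map_mat f (jordan_matrix bs) = jordan_matrix (map (\<lambda>(m, z). (m, f z)) bs)"
proof (induction bs)
  case Nil
  show ?case by (auto simp: jordan_matrix_def)
next
  case (Cons b bs)
  obtain m z where b: "b = (m, z)" by force
  have fst: "fst (case x of (m, z) \<Rightarrow> (m, f z)) = fst x" for x
    by (cases x) simp
  have "map_mat f (jordan_block m z) = jordan_block m (f z)"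
    by (rule eq_matI) (simp_all add: assms)
  moreover have "map_mat f (0\<^sub>m k l) = 0\<^sub>m k l" for k l
    by (rule eq_matI) (simp_all add: assms)
  ultimately show ?case
    by (simp add: b jordan_matrix_Cons map_four_block_mat[where ?nr1.0 = m and ?nc1.0 = m
        and ?nr2.0 = "sum_list (map fst bs)" and ?nc2.0 = "sum_list (map fst bs)"]
        Cons.IH o_def fst assms)
qed

lemma complexify_jordan_matrix:
  "complexify (jordan_matrix (map (\<lambda>(m, z). (m, quat_of_complex z)) bs)) =
     jordan_matrix (bs @ map (\<lambda>(m, z). (m, cnj z)) bs)"
proof -
  have fst: "fst (case x of (m, z) \<Rightarrow> (m, cnj z)) = fst x" for x
    by (cases x) simp
  have "complexify (map_mat quat_of_complex (jordan_matrix bs)) =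
    four_block_mat (jordan_matrix bs)
      (0\<^sub>m (sum_list (map fst bs)) (sum_list (map fst bs)))
      (0\<^sub>m (sum_list (map fst bs)) (sum_list (map fst bs))) (map_mat cnj (jordan_matrix bs))"
    unfolding complexify_def by (intro cong_four_block_mat eq_matI) simp_all
  then show ?thesis
    by (simp add: map_mat_jordan_matrix jordan_matrix_append o_def fst)
qed

section \<open>Multiplicities of Jordan blocks\<close>

text \<open>For \<open>m > 0\<close> the number of blocks is given by dimensions of generalised
  eigenspaces, which depend on \<open>A\<close> alone; blocks of size 0 are excluded by
  \<open>jordan_nf\<close>.\<close>

lemma jordan_nf_unique_count:
  fixes A :: "'a::field mat"
  assumes "jordan_nf A bs" and "jordan_nf A cs"
  shows "count (mset bs) (m, z) = count (mset cs) (m, z)"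
proof (cases "m = 0")
  case True
  have "(0, z) \<notin> set bs" "(0, z) \<notin> set cs"
    using assms by (force simp: jordan_nf_def)+
  then show ?thesis
    by (simp add: True count_mset count_list_0_iff)
next
  case False
  show ?thesis
    using compute_nr_of_jordan_blocks[OF assms(1) False, of z]
      compute_nr_of_jordan_blocks[OF assms(2) False, of z]
    by (simp add: count_mset count_list_eq_length_filter)
qed

lemma count_map_inverse:
  assumes "\<And>x. g (f x) = x" and "\<And>x. f (g x) = x"
  shows "count (mset (map f xs)) y = count (mset xs) (g y)"
  using assms by (induction xs) auto

lemma Ad_real_jordan_count:
  assumes "Ad_real n A" and "quat_jordan_form A bs"
  shows "count (mset bs) (m, z) = count (mset bs) (m, - cnj z)"
proof -
  define cs where "cs = bs @ map (\<lambda>(m, z). (m, cnj z)) bs"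
  have A: "A \<in> carrier_mat n n" and "similar_mat (- A) A"
    using assms(1) by (auto simp: Ad_real_def similar_mat_def)
  then have sim_neg: "similar_mat (- complexify A) (complexify A)"
    using similar_mat_complexify[of "- A" A] by (simp add: complexify_uminus)
  have "similar_mat A (jordan_matrix (map (\<lambda>(m, z). (m, quat_of_complex z)) bs))"
    using assms(2) by (simp add: quat_jordan_form_def jordan_nf_def)
  then have "similar_mat (complexify A) (jordan_matrix cs)"
    unfolding cs_def complexify_jordan_matrix[symmetric] by (rule similar_mat_complexify)
  moreover have "0 \<notin> fst ` set cs"
    using assms(2) by (force simp: quat_jordan_form_def jordan_nf_def cs_def)
  ultimately have jnf: "jordan_nf (complexify A) cs"
    by (simp add: jordan_nf_def)
  have "(-1) \<cdot>\<^sub>m complexify A = - complexify A"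
    by (rule eq_matI) auto
  then have "jordan_nf (- complexify A) (map (\<lambda>(m, z). (m, - z)) cs)"
    using jordan_nf_smult[OF jnf, of "-1"] by simp
  \<comment> \<open>Similarity of \<open>complexify A\<close> to its negative gives it a second
    Jordan form, so its block counts are invariant under negating the eigenvalue.\<close>
  then have "jordan_nf (complexify A) (map (\<lambda>(m, z). (m, - z)) cs)"
    using similar_mat_trans[OF similar_mat_sym[OF sim_neg]] by (auto simp: jordan_nf_def)
  from jordan_nf_unique_count[OF jnf this]
  have "count (mset cs) (m, w) = count (mset cs) (m, - w)" for w
    by (subst (asm) count_map_inverse[where g = "\<lambda>(m, z). (m, - z)"]) auto
  moreover have "count (mset cs) (m, w) = count (mset bs) (m, w) + count (mset bs) (m, cnj w)" for w
    unfolding cs_def mset_append count_union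
    by (subst count_map_inverse[where g = "\<lambda>(m, z). (m, cnj z)"]) auto
  ultimately have counts: "count (mset bs) (m, w) + count (mset bs) (m, cnj w) =
      count (mset bs) (m, - w) + count (mset bs) (m, - cnj w)" for w
    by (metis complex_cnj_minus)
  have zero: "count (mset bs) (m, w) = 0" if "Im w < 0" for w
    using assms(2) that by (force simp: quat_jordan_form_def count_mset count_list_0_iff)
  show ?thesis
  \<comment> \<open>\<open>z\<close> and \<open>- cnj z\<close> have the same imaginary part. If it
    is zero, \<open>counts\<close> is twice the claim; if negative, neither eigenvalue occurs; if
    positive, the conjugate terms in \<open>counts\<close> vanish.\<close>
  proof (cases "Im z" "0 :: real" rule: linorder_cases)
    case equal
    then have "cnj z = z" by (simp add: complex_eq_iff)
    then show ?thesis using counts[of z] by simp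
  next
    case less
    then show ?thesis by (simp add: zero)
  next
    case greater
    then show ?thesis using counts[of z] by (simp add: zero)
  qed
qed

section \<open>Strong reality of block sums\<close>

lemma strongly_Ad_real_carrier: "strongly_Ad_real n X \<Longrightarrow> X \<in> carrier_mat n n"
  by (simp add: strongly_Ad_real_def)

lemma strongly_Ad_realI:
  assumes "X \<in> carrier_mat n n" "g \<in> carrier_mat n n" "g * g = 1\<^sub>m n" "- X = g * X * g"
  shows "strongly_Ad_real n X"
  using assms similar_mat_witI[of g g n "- X" X] by (auto simp: strongly_Ad_real_def)

text \<open>An involution is its own inverse, so the second matrix of \<open>similar_mat_wit\<close>
  coincides with \<open>g\<close>.\<close>

lemma strongly_Ad_realE:
  assumes "strongly_Ad_real n X"
  obtains g where "X \<in> carrier_mat n n" "g \<in> carrier_mat n n" "g * g = 1\<^sub>m n" "- X = g * X * g"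
proof -
  obtain g h where X: "X \<in> carrier_mat n n" and wit: "similar_mat_wit (- X) X g h"
    and gg: "g * g = 1\<^sub>m n"
    using assms by (auto simp: strongly_Ad_real_def)
  note w = similar_mat_witD2[OF uminus_carrier_mat[OF X] wit]
  have "g = g * (g * h)"
    using w(1,6) by simp
  also have "\<dots> = g * g * h"
    using w(6,7) by (rule assoc_mult_mat[OF w(6), symmetric])
  also have "\<dots> = h"
    using w(7) by (simp add: gg)
  finally show thesis
    using that X gg w by metis
qed

text \<open>The involution is carried along the change of basis: \<open>Q * g * P\<close> serves for
  \<open>X\<close>.\<close>

lemma strongly_Ad_real_similar:
  assumes "similar_mat X Y" and "strongly_Ad_real n Y"
  shows "strongly_Ad_real n X"
proof -
  obtain g where Y: "Y \<in> carrier_mat n n" and g: "g \<in> carrier_mat n n"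
    and gg: "g * g = 1\<^sub>m n" and gY: "- Y = g * Y * g"
    using strongly_Ad_realE[OF assms(2)] .
  obtain P Q where wit: "similar_mat_wit Y X P Q"
    using similar_mat_sym[OF assms(1)] by (auto simp: similar_mat_def)
  note w = similar_mat_witD2[OF Y wit]
  note wit' = similar_mat_wit_sym[OF wit]
  note w' = similar_mat_witD2[OF w(5) wit']
  note assoc = assoc_mult_mat[where ?n\<^sub>1.0 = n and ?n\<^sub>2.0 = n and ?n\<^sub>3.0 = n and ?n\<^sub>4.0 = n]
  \<comment> \<open>Products get associated to the right below, so inverse pairs have to cancel in
    front of a further factor \<open>Z\<close>.\<close>
  have PQ: "P * (Q * Z) = Z" if "Z \<in> carrier_mat n n" for Z
    using w(1,6,7) that by (simp flip: assoc)
  have ggZ: "g * (g * Z) = Z" if "Z \<in> carrier_mat n n" for Z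
    using g gg that by (simp flip: assoc)
  show ?thesis
  proof (rule strongly_Ad_realI)
    show "X \<in> carrier_mat n n" "Q * g * P \<in> carrier_mat n n"
      using w(5-7) g by auto
    show "Q * g * P * (Q * g * P) = 1\<^sub>m n"
      using w(2,6,7) g gg by (simp add: assoc PQ ggZ)
    have "- X = Q * (- Y) * P"
      using w'(3) w(6,7) Y by simp
    also have "\<dots> = Q * (g * Y * g) * P"
      by (simp add: gY)
    also have "\<dots> = Q * g * P * X * (Q * g * P)"
      using w(5-7) Y g unfolding w'(3) by (simp add: assoc PQ)
    finally show "- X = Q * g * P * X * (Q * g * P)" .
  qed
qed

lemma uminus_four_block_diag:
  fixes X Y :: "'a::group_add mat"
  assumes "X \<in> carrier_mat n n" and "Y \<in> carrier_mat m m"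
  shows "- four_block_mat X (0\<^sub>m n m) (0\<^sub>m m n) Y = four_block_mat (- X) (0\<^sub>m n m) (0\<^sub>m m n) (- Y)"
  using assms by (intro eq_matI) auto

lemma strongly_Ad_real_four_block:
  assumes "strongly_Ad_real n X" and "strongly_Ad_real m Y"
  shows "strongly_Ad_real (n + m) (four_block_mat X (0\<^sub>m n m) (0\<^sub>m m n) Y)"
proof -
  obtain g where g: "X \<in> carrier_mat n n" "g \<in> carrier_mat n n" "g * g = 1\<^sub>m n" "- X = g * X * g"
    using strongly_Ad_realE[OF assms(1)] .
  obtain h where h: "Y \<in> carrier_mat m m" "h \<in> carrier_mat m m" "h * h = 1\<^sub>m m" "- Y = h * Y * h"
    using strongly_Ad_realE[OF assms(2)] .
  note mult = mult_four_block_mat[where ?nr1.0 = n and ?nr2.0 = m and ?n1.0 = n and ?n2.0 = m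
      and ?nc1.0 = n and ?nc2.0 = m]
  show ?thesis
    by (rule strongly_Ad_realI[where g = "four_block_mat g (0\<^sub>m n m) (0\<^sub>m m n) h"])
      (use g h in \<open>simp_all add: mult uminus_four_block_diag\<close>)
qed

text \<open>The off-diagonal matrix with blocks \<open>P\<close> and \<open>Q\<close> squares to 1
  because these are mutually inverse. Conjugation by it turns the diagonal blocks \<open>X\<close>,
  \<open>Y\<close> into \<open>P * Y * Q = - X\<close> and \<open>Q * X * P = - Y\<close>.\<close>

lemma strongly_Ad_real_swap:
  assumes X: "X \<in> carrier_mat n n" and wit: "similar_mat_wit (- X) Y P Q"
  shows "strongly_Ad_real (n + n) (four_block_mat X (0\<^sub>m n n) (0\<^sub>m n n) Y)"
proof -
  have X': "- X \<in> carrier_mat n n" using X by simp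
  note w = similar_mat_witD2[OF X' wit]
  note w' = similar_mat_witD2[OF w(5) similar_mat_wit_sym[OF wit]]
  have X_eq: "P * Y * Q = - X" using w(3) ..
  have "- Y = - (Q * (- X) * P)" using w'(3) by simp
  also have "\<dots> = Q * X * P" using w(6,7) X by simp
  finally have Y_eq: "Q * X * P = - Y" ..
  note mult = mult_four_block_mat[where ?nr1.0 = n and ?nr2.0 = n and ?n1.0 = n and ?n2.0 = n
      and ?nc1.0 = n and ?nc2.0 = n]
  show ?thesis
    by (rule strongly_Ad_realI[where g = "four_block_mat (0\<^sub>m n n) P Q (0\<^sub>m n n)"])
      (use X w(1,2,5-7) in \<open>simp_all add: mult uminus_four_block_diag X_eq Y_eq\<close>)
qed

section \<open>Rearranging the blocks of a Jordan matrix\<close>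

lemma similar_mat_four_block_commute:
  fixes X Y :: "'a::semiring_1 mat"
  assumes X: "X \<in> carrier_mat n n" and Y: "Y \<in> carrier_mat m m"
  shows "similar_mat (four_block_mat X (0\<^sub>m n m) (0\<^sub>m m n) Y)
    (four_block_mat Y (0\<^sub>m m n) (0\<^sub>m n m) X)"
proof (rule similar_matI)
  let ?P = "four_block_mat (0\<^sub>m n m) (1\<^sub>m n) (1\<^sub>m m) (0\<^sub>m m n) :: 'a mat"
  let ?Q = "four_block_mat (0\<^sub>m m n) (1\<^sub>m m) (1\<^sub>m n) (0\<^sub>m n m) :: 'a mat"
  let ?Z = "four_block_mat Y (0\<^sub>m m n) (0\<^sub>m n m) X"
  have P: "?P \<in> carrier_mat (n + m) (n + m)" and Q: "?Q \<in> carrier_mat (n + m) (n + m)"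
    by (rule carrier_matI; simp)+
  then show "{four_block_mat X (0\<^sub>m n m) (0\<^sub>m m n) Y, ?Z, ?P, ?Q} \<subseteq> carrier_mat (n + m) (n + m)"
    using X Y by (auto simp: add.commute[of n m])
  show "?P * ?Q = 1\<^sub>m (n + m)"
    by (subst mult_four_block_mat[where ?nr1.0 = n and ?nr2.0 = m and ?n1.0 = m and ?n2.0 = n
          and ?nc1.0 = n and ?nc2.0 = m]) simp_all
  have "?Q * ?P = 1\<^sub>m (m + n)"
    by (subst mult_four_block_mat[where ?nr1.0 = m and ?nr2.0 = n and ?n1.0 = n and ?n2.0 = m
          and ?nc1.0 = m and ?nc2.0 = n]) simp_all
  then show "?Q * ?P = 1\<^sub>m (n + m)" by (simp add: add.commute)
  have "?P * ?Z = four_block_mat (0\<^sub>m n m) X Y (0\<^sub>m m n)"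
    using X Y
    by (subst mult_four_block_mat[where ?nr1.0 = n and ?nr2.0 = m and ?n1.0 = m and ?n2.0 = n
          and ?nc1.0 = m and ?nc2.0 = n]) simp_all
  also have "\<dots> * ?Q = four_block_mat X (0\<^sub>m n m) (0\<^sub>m m n) Y"
    using X Y
    by (subst mult_four_block_mat[where ?nr1.0 = n and ?nr2.0 = m and ?n1.0 = m and ?n2.0 = n
          and ?nc1.0 = n and ?nc2.0 = m]) simp_all
  finally show "four_block_mat X (0\<^sub>m n m) (0\<^sub>m m n) Y = ?P * ?Z * ?Q" ..
qed

text \<open>Serves to bring two blocks that form a pair next to each other at the front.\<close>

lemma similar_mat_jordan_matrix_move:
  fixes xs ys zs :: "(nat \<times> 'a::semiring_1) list"
  shows "similar_mat (jordan_matrix (xs @ ys @ zs)) (jordan_matrix (ys @ xs @ zs))"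
proof -
  have sim: "similar_mat (jordan_matrix (xs @ ys)) (jordan_matrix (ys @ xs))"
    unfolding jordan_matrix_append
    by (rule similar_mat_four_block_commute[OF jordan_matrix_carrier jordan_matrix_carrier])
  have dim: "sum_list (map fst (ys @ xs)) = sum_list (map fst (xs @ ys))"
    by simp
  have "similar_mat (jordan_matrix ((xs @ ys) @ zs)) (jordan_matrix ((ys @ xs) @ zs))"
    unfolding jordan_matrix_append[of _ zs] dim
    by (rule similar_mat_four_block_0_0[OF sim similar_mat_refl[OF jordan_matrix_carrier]
          jordan_matrix_carrier jordan_matrix_carrier])
  then show ?thesis by simp
qed

section \<open>Jordan blocks over the quaternions\<close>

text \<open>Combines two effects under conjugation: the alternating signs act on the superdiagonal,
  the factor \<open>u\<close> on the eigenvalue.\<close>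

definition alternating_mat :: "nat \<Rightarrow> 'a::ring_1 \<Rightarrow> 'a mat" where
  "alternating_mat n u = mat n n (\<lambda>(i, j). if i = j then (- 1) ^ i * u else 0)"

lemma alternating_mat_carrier [simp]: "alternating_mat n u \<in> carrier_mat n n"
  by (simp add: alternating_mat_def)

lemma alternating_mat_mult_left:
  assumes "A \<in> carrier_mat n n"
  shows "alternating_mat n u * A = mat n n (\<lambda>(i, j). (- 1) ^ i * u * A $$ (i, j))"
  using assms
  by (intro eq_matI) (auto simp: alternating_mat_def scalar_prod_def if_distrib[of "\<lambda>x. x * _"] cong: if_cong)

lemma alternating_mat_mult_right:
  assumes "A \<in> carrier_mat n n"
  shows "A * alternating_mat n u = mat n n (\<lambda>(i, j). A $$ (i, j) * ((- 1) ^ j * u))"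
  using assms
  by (intro eq_matI) (auto simp: alternating_mat_def scalar_prod_def if_distrib[of "\<lambda>x. _ * x"] cong: if_cong)

text \<open>On the diagonal the signs cancel and \<open>u * b * v = - a\<close> remains; on the
  superdiagonal adjacent signs differ, so each 1 becomes \<open>- (u * v) = - 1\<close>.\<close>

lemma similar_mat_wit_jordan_block_uminus:
  fixes a b u v :: "'a::ring_1"
  assumes uv: "u * v = 1" "v * u = 1" and ab: "u * b * v = - a"
  shows "similar_mat_wit (- jordan_block n a) (jordan_block n b)
    (alternating_mat n u) (alternating_mat n v)"
proof (rule similar_mat_witI)
  have inv: "alternating_mat n x * alternating_mat n y = 1\<^sub>m n" if "x * y = 1" for x y :: 'a
  proof -
    have "(- 1) ^ i * x * ((- 1) ^ i * y) = 1" for i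
      using that by (cases "even i") simp_all
    then show ?thesis
      unfolding alternating_mat_mult_left[OF alternating_mat_carrier]
      by (intro eq_matI) (simp_all add: alternating_mat_def)
  qed
  show "alternating_mat n u * alternating_mat n v = 1\<^sub>m n"
    "alternating_mat n v * alternating_mat n u = 1\<^sub>m n"
    using inv uv by simp_all
  have diag: "(- 1) ^ i * u * b * ((- 1) ^ i * v) = - a" for i
    using ab by (cases "even i") simp_all
  have superdiag: "(- 1) ^ i * u * ((- 1) ^ Suc i * v) = - 1" for i
    using uv by (cases "even i") simp_all
  show "- jordan_block n a = alternating_mat n u * jordan_block n b * alternating_mat n v"
    unfolding alternating_mat_mult_right[OF mult_carrier_mat[OF alternating_mat_carrier jordan_block_carrier]]
    unfolding alternating_mat_mult_left[OF jordan_block_carrier]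
    using diag superdiag by (intro eq_matI) auto
qed simp_all

lemma strongly_Ad_real_jordan_block_zero: "strongly_Ad_real m (jordan_block m 0)"
proof -
  have wit: "similar_mat_wit (- jordan_block m 0) (jordan_block m (0 :: quat))
      (alternating_mat m 1) (alternating_mat m 1)"
    by (rule similar_mat_wit_jordan_block_uminus) simp_all
  then show ?thesis
    \<comment> \<open>Both witnesses are the same matrix, so their inverse relation already says
      that it is an involution.\<close>
    using similar_mat_witD2(1)[OF uminus_carrier_mat[OF jordan_block_carrier] wit]
    unfolding strongly_Ad_real_def by auto
qed

lemma strongly_Ad_real_jordan_pair:
  "strongly_Ad_real (m + m) (four_block_mat (jordan_block m (quat_of_complex z)) (0\<^sub>m m m)
     (0\<^sub>m m m) (jordan_block m (quat_of_complex (- cnj z))))"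
proof (rule strongly_Ad_real_swap[OF jordan_block_carrier])
  \<comment> \<open>Conjugation by \<open>j\<close> is complex conjugation on \<open>\<complex>\<close>.\<close>
  show "similar_mat_wit (- jordan_block m (quat_of_complex z))
      (jordan_block m (quat_of_complex (- cnj z)))
      (alternating_mat m (Quat 0 0 1 0)) (alternating_mat m (Quat 0 0 (- 1) 0))"
    by (rule similar_mat_wit_jordan_block_uminus)
      (simp_all add: times_quat_def one_quat_def uminus_quat_def quat_of_complex_def)
qed

section \<open>Pairing off the Jordan blocks\<close>

text \<open>Induction on the length of \<open>bs\<close>: a leading block with eigenvalue 0 is split
  off alone, any other together with a partner. Both hypotheses survive the removal.\<close>

lemma strongly_Ad_real_jordan_matrix:
  assumes "\<And>m z. count (mset bs) (m, z) = count (mset bs) (m, - cnj z)"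
    and "\<And>m z. Re z = 0 \<Longrightarrow> z \<noteq> 0 \<Longrightarrow> even (count (mset bs) (m, z))"
  shows "strongly_Ad_real (sum_list (map fst bs))
    (jordan_matrix (map (\<lambda>(m, z). (m, quat_of_complex z)) bs))"
  using assms
proof (induction bs rule: length_induct)
  case (1 bs)
  let ?q = "map (\<lambda>(m, z). (m, quat_of_complex z))"
  have fst_comp: "fst \<circ> (\<lambda>(m, z). (m, quat_of_complex z)) = fst"
    by auto
  have fst: "map fst (?q xs) = map fst xs" for xs
    by (simp add: fst_comp)
  note sym = "1.prems"(1) and ev = "1.prems"(2)
  show ?case
  proof (cases bs)
    case Nil
    have "- (0\<^sub>m 0 0) = (0\<^sub>m 0 0 :: quat mat)" by (rule eq_matI) auto
    then show ?thesis
      by (intro strongly_Ad_realI[where g = "1\<^sub>m 0"]) (simp_all add: Nil jordan_matrix_def)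
  next
    case (Cons b cs)
    obtain m z where b: "b = (m, z)" by force
    show ?thesis
    proof (cases "z = 0")
      case True
      have "strongly_Ad_real (sum_list (map fst cs)) (jordan_matrix (?q cs))"
      proof (rule "1.IH"[rule_format])
        show "length cs < length bs" by (simp add: Cons)
        show "count (mset cs) (k, w) = count (mset cs) (k, - cnj w)" for k w
          using sym[of k w] by (auto simp: Cons b True split: if_splits)
        show "even (count (mset cs) (k, w))" if "Re w = 0" "w \<noteq> 0" for k w
          using ev[OF that, of k] that by (auto simp: Cons b True split: if_splits)
      qed
      then show ?thesis
        using strongly_Ad_real_four_block[OF strongly_Ad_real_jordan_block_zero[of m]]
        by (simp add: Cons b True jordan_matrix_Cons fst_comp)
    next
      case False
      \<comment> \<open>The partner exists by parity if \<open>z\<close> lies on the imaginary axis,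
        where it is a second copy of the same block; otherwise by the symmetry of the
        counts.\<close>
      have "(m, - cnj z) \<in> set cs"
      proof (cases "- cnj z = z")
        case True
        then have "Re z = 0" by (simp add: complex_eq_iff)
        from ev[OF this False, of m] have "odd (count (mset cs) (m, z))"
          by (simp add: Cons b)
        then show ?thesis using True by (metis count_eq_zero_iff even_zero set_mset_mset)
      next
        case False
        with sym[of m z] have "count (mset cs) (m, - cnj z) = Suc (count (mset cs) (m, z))"
          by (simp add: Cons b)
        then show ?thesis by (metis count_eq_zero_iff nat.distinct(1) set_mset_mset)
      qed
      then obtain xs ys where cs: "cs = xs @ (m, - cnj z) # ys"
        by (meson split_list)
      have rest: "strongly_Ad_real (sum_list (map fst (xs @ ys))) (jordan_matrix (?q (xs @ ys)))"
      proof (rule "1.IH"[rule_format])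
        show "length (xs @ ys) < length bs" by (simp add: Cons cs)
        \<comment> \<open>The map \<open>w\<close> to \<open>- cnj w\<close> is an involution, so
          removing the pair lowers the counts at \<open>w\<close> and \<open>- cnj w\<close>
          equally.\<close>
        have swap: "z = - cnj w \<longleftrightarrow> - cnj z = w" for w
          by (auto simp: complex_eq_iff)
        show "count (mset (xs @ ys)) (k, w) = count (mset (xs @ ys)) (k, - cnj w)" for k w
          using sym[of k w] swap[of w] by (auto simp: Cons b cs split: if_splits)
        show "even (count (mset (xs @ ys)) (k, w))" if w: "Re w = 0" "w \<noteq> 0" for k w
        proof -
          have "- cnj w = w" using w by (simp add: complex_eq_iff)
          then show ?thesis
            using ev[OF w, of k] swap[of w] by (auto simp: Cons b cs split: if_splits)
        qed
      qed
      let ?pair = "[(m, quat_of_complex z), (m, quat_of_complex (- cnj z))]"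
      have "jordan_matrix ?pair = four_block_mat (jordan_block m (quat_of_complex z)) (0\<^sub>m m m)
          (0\<^sub>m m m) (jordan_block m (quat_of_complex (- cnj z)))"
        using jordan_matrix_append[of "[(m, quat_of_complex z)]" "[(m, quat_of_complex (- cnj z))]"]
        by (simp add: jordan_matrix_def del: diag_block_mat.simps)
      then have pair: "strongly_Ad_real (m + m) (jordan_matrix ?pair)"
        using strongly_Ad_real_jordan_pair[of m z] by simp
      have "strongly_Ad_real (sum_list (map fst bs)) (jordan_matrix (?pair @ ?q (xs @ ys)))"
        using strongly_Ad_real_four_block[OF pair rest]
        unfolding jordan_matrix_append[of ?pair] fst by (simp add: Cons b cs fst_comp add_ac)
      \<comment> \<open>Two moves: the partner goes to the very front, then the block of
        \<open>z\<close> is put before it.\<close>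
      moreover have "similar_mat (jordan_matrix (?q bs)) (jordan_matrix (?pair @ ?q (xs @ ys)))"
        using similar_mat_jordan_matrix_move[of "(m, quat_of_complex z) # ?q xs"
            "[(m, quat_of_complex (- cnj z))]" "?q ys"]
          similar_mat_jordan_matrix_move[of "[(m, quat_of_complex (- cnj z))]"
            "[(m, quat_of_complex z)]" "?q xs @ ?q ys"]
        by (auto simp: Cons b cs intro: similar_mat_trans)
      ultimately show ?thesis
        using strongly_Ad_real_similar by blast
    qed
  qed
qed

theorem theorem4p4:
  fixes n :: nat and A :: "quat mat" and bs :: "(nat \<times> complex) list"
  assumes "A \<in> carrier_mat n n"
    and "Ad_real n A"
    and "quat_jordan_form A bs"
    and "\<And>(\<nu>::real) (m::nat). \<nu> > 0 \<Longrightarrow> m \<ge> 1 \<Longrightarrow>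
           even (count (mset bs) (m, complex_of_real \<nu> * \<i>))"
  shows "strongly_Ad_real n A"
proof -
  let ?J = "jordan_matrix (map (\<lambda>(m, z). (m, quat_of_complex z)) bs)"
  have pos: "m \<ge> 1" "Im z \<ge> 0" if "(m, z) \<in> set bs" for m z
    using assms(3) that by (force simp: quat_jordan_form_def jordan_nf_def)+
  have J: "strongly_Ad_real (sum_list (map fst bs)) ?J"
  proof (rule strongly_Ad_real_jordan_matrix)
    show "count (mset bs) (m, z) = count (mset bs) (m, - cnj z)" for m z
      by (rule Ad_real_jordan_count[OF assms(2,3)])
    show "even (count (mset bs) (m, z))" if z: "Re z = 0" "z \<noteq> 0" for m z
    \<comment> \<open>The parity hypothesis speaks only of the upper half of the imaginary axis; a
      block that occurs has \<open>Im z \<ge> 0\<close>, and any other has count 0.\<close>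
    proof (cases "(m, z) \<in> set bs")
      case True
      have "z = complex_of_real (Im z) * \<i>"
        using z by (simp add: complex_eq_iff)
      moreover have "Im z > 0"
        using z pos[OF True] by (simp add: complex_eq_iff)
      ultimately show ?thesis
        using assms(4)[of "Im z" m] pos[OF True] by simp
    next
      case False
      then show ?thesis by (simp add: count_mset count_list_0_iff)
    qed
  qed
  have sim: "similar_mat A ?J"
    using assms(3) by (simp add: quat_jordan_form_def jordan_nf_def)
  \<comment> \<open>Similarity forces the total block size to be the dimension
    \<open>n\<close>.\<close>
  have "A \<in> carrier_mat (sum_list (map fst bs)) (sum_list (map fst bs))"
    using strongly_Ad_real_carrier[OF strongly_Ad_real_similar[OF sim J]] .
  then have "sum_list (map fst bs) = n"
    using assms(1) by (metis carrier_matD(1))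
  then show ?thesis
    using strongly_Ad_real_similar[OF sim J] by simp
qed

end
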